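(* Let $G=(V,E)$ be a finite undirected graph with terminal set $R\subseteq V$, root $r\in R$, commodity set $K$ and $b=|K|$, and let $c\ge 0$ be the cost vector of the Steiner tree instance. Assume $\mathcal{Q}_l$ is nonempty for all $l\in\mathcal{L}_b$. For each $l\in\mathcal{L}_b$ let $x^l\in\mathrm{Argmin}\{c^Tx: x\in\mathcal{Q}_l\}$ and $v^l=c^Tx^l$, where for $x=(f,w,\hat y,\overline y)$ one writes $c^Tx=\sum_{a\in A}c_a\sum_{s\in S(l)}f_a^s$. Let $l^*\in\mathrm{Argmin}\{v^l: l\in\mathcal{L}_b\}$. Then $\phi(x^{l^*})$ is a minimum cost Steiner tree of $G$.
   Context: Setting. $G=(V,E)$ is a finite undirected graph with edge costs $c_e\ge 0$, and $R\subseteq V$ is a set of terminal nodes with $|R|\ge2$. A Steiner tree is a subgraph of $G$ that is a tree and contains all nodes of $R$; its cost is the sum of the costs of its edges. $D=(V,A)$ is the directed graph having, for every edge $e=\{i,j\}\in E$, the two arcs $(i,j)$ and $(j,i)$ in $A$, each of cost $c_a=c_e$; $A(e)$ is the set of these two arcs. $\delta^+(i)$ and $\delta^-(i)$ are the sets of arcs of $D$ leaving and entering node $i$. A root $r\in R$ is fixed. $K$ is a set of commodities, one for each node of $R\setminus\{r\}$; commodity $k$ has source $r$ and sink $t_k$, its corresponding node in $R\setminus\{r\}$. Put $b=|K|$. Laminar families. A family of sets is laminar if any two members $A,B$ satisfy $A\subseteq B$, $B\subseteq A$ or $A\cap B=\emptyset$. $\mathcal{L}_b$ is the set of all laminar families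 $l$ of nonempty subsets of $K$ that contain $K$ and all singletons $\{k\}$, $k\in K$. For $l\in\mathcal{L}_b$, $S(l)$ is the set of subsets of $K$ belonging to $l$. For $s\in S(l)$ with $|s|\ge 2$, the child sets of $s$ are the inclusion-maximal members of $S(l)$ properly contained in $s$; they form a partition of $s$ into at least two parts, denoted $P_l(s)$. $P(l)=\{P_l(s): s\in S(l),|s|\ge2\}$, and for $p\in P(l)$, $S_l(p)$ is the set of child sets that make up $p$. The feasible set $\mathcal{Q}_l$. $\mathcal{Q}_l$ is the set of all $x=(f,w,\hat y,\overline y)$ with $f\in\{0,1\}^{|A|\times|S(l)|}$, $\hat y,\overline y\in\{0,1\}^{|V|\times|S(l)|}$, $w\in\{0,1\}^{|V|\times|P(l)|}$ satisfying - $\sum_{a\in\delta^+(i)}f_a^s-\sum_{a\in\delta^-(i)}f_a^s=\hat y_i^s-\overline y_i^s$ for all $i\in V$, $s\in S(l)$; - $w_i^{p}=\overline y_i^s$ for all $i\in V$, $s\in S(l)$ with $|s|\ge 2$, and $p=P_l(s)$; - $w_i^p=\hat y_i^s$ for all $i\in V$, $p\in P(l)$, $s\in S_l(p)$; - $\sum_{i\in V}w_i^p=1$ for all $p\in P(l)$; - $\hat y_r^K=1$, and $\hat y_i^K=0$ for all $i\in V\setminus\{r\}$; - $\overline y_{t_k}^{\{k\}}=1$, and $\overline y_i^{\{k\}}=0$ for all $k\in K$, $i\in V\setminus\{t_k\}$. The map $\phi$. For $x=(f,w,\hat y,\overline y)\in\mathcal{Q}_l$, $\phi(x)=\chi\in\{0,1\}^{|E|}$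 with $\chi_e=\min\{1,\sum_{s\in S(l)}\sum_{a\in A(e)}f_a^s\}$ for all $e\in E$. A vector $\chi\in\{0,1\}^{|E|}$ is identified with the subgraph of $G$ formed by the edges $e$ with $\chi_e=1$ and their end nodes.
   Formalization: False if an optimal solution has a zero-cost circulation. Proved instead: φ(x^{l*}) is a minimum cost Steiner tree if all its edges have positive cost; for any c ≥ 0 it contains a minimum cost Steiner tree and its other edges cost 0 (so it is one whenever it is a tree). *)

theory Defs
  imports Complex_Main
begin

section \<open>Undirected graphs, trees and Steiner trees\<close>

text \<open>A graph is a pair \<open>(V, E)\<close>; an edge is the two-element set of its end nodes.\<close>

type_synonym 'v ugraph = "'v set \<times> 'v set set"

definition wf_ugraph :: "'v ugraph \<Rightarrow> bool" where
  "wf_ugraph G \<longleftrightarrow> finite (fst G) \<and> (\<forall>e\<in>snd G. e \<subseteq> fst G \<and> card e = 2)"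

definition subgraph :: "'v ugraph \<Rightarrow> 'v ugraph \<Rightarrow> bool" where
  "subgraph H G \<longleftrightarrow> wf_ugraph H \<and> fst H \<subseteq> fst G \<and> snd H \<subseteq> snd G"

definition connected_ugraph :: "'v ugraph \<Rightarrow> bool" where
  "connected_ugraph G \<longleftrightarrow>
     fst G \<noteq> {} \<and> (\<forall>u\<in>fst G. \<forall>v\<in>fst G. (u, v) \<in> {(i, j). {i, j} \<in> snd G}\<^sup>*)"

definition ucycle :: "'v ugraph \<Rightarrow> 'v list \<Rightarrow> bool" where
  "ucycle G vs \<longleftrightarrow> 3 \<le> length vs \<and> distinct vs \<and>
     successively (\<lambda>i j. {i, j} \<in> snd G) vs \<and> {last vs, hd vs} \<in> snd G"

definition is_tree :: "'v ugraph \<Rightarrow> bool" where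
  "is_tree G \<longleftrightarrow> wf_ugraph G \<and> connected_ugraph G \<and> (\<nexists>vs. ucycle G vs)"

definition steiner_tree :: "'v ugraph \<Rightarrow> 'v set \<Rightarrow> 'v ugraph \<Rightarrow> bool" where
  "steiner_tree G R T \<longleftrightarrow> subgraph T G \<and> is_tree T \<and> R \<subseteq> fst T"

definition graph_cost :: "('v set \<Rightarrow> real) \<Rightarrow> 'v ugraph \<Rightarrow> real" where
  "graph_cost c H = (\<Sum>e\<in>snd H. c e)"

definition min_cost_steiner_tree ::
  "'v ugraph \<Rightarrow> ('v set \<Rightarrow> real) \<Rightarrow> 'v set \<Rightarrow> 'v ugraph \<Rightarrow> bool" where
  "min_cost_steiner_tree G c R T \<longleftrightarrow> is_arg_min (graph_cost c) (steiner_tree G R) T"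

text \<open>\<open>t k\<close> is the sink of commodity \<open>k\<close>; the common source is the root \<open>r\<close>.\<close>

definition steiner_instance ::
  "'v ugraph \<Rightarrow> ('v set \<Rightarrow> real) \<Rightarrow> 'v set \<Rightarrow> 'v \<Rightarrow> 'k set \<Rightarrow> ('k \<Rightarrow> 'v) \<Rightarrow> bool" where
  "steiner_instance G c R r K t \<longleftrightarrow>
     wf_ugraph G \<and> (\<forall>e\<in>snd G. 0 \<le> c e) \<and>
     R \<subseteq> fst G \<and> 2 \<le> card R \<and> r \<in> R \<and> bij_betw t K (R - {r})"

section \<open>The bidirected graph\<close>

definition arcs :: "'v ugraph \<Rightarrow> ('v \<times> 'v) set" where
  "arcs G = {(i, j). {i, j} \<in> snd G}"

definition arcs_of_edge :: "'v set \<Rightarrow> ('v \<times> 'v) set" where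
  "arcs_of_edge e = {(i, j). {i, j} = e}"

definition arc_cost :: "('v set \<Rightarrow> real) \<Rightarrow> 'v \<times> 'v \<Rightarrow> real" where
  "arc_cost c a = c {fst a, snd a}"

definition out_arcs :: "'v ugraph \<Rightarrow> 'v \<Rightarrow> ('v \<times> 'v) set" where
  "out_arcs G i = {a \<in> arcs G. fst a = i}"

definition in_arcs :: "'v ugraph \<Rightarrow> 'v \<Rightarrow> ('v \<times> 'v) set" where
  "in_arcs G i = {a \<in> arcs G. snd a = i}"

section \<open>Laminar families\<close>

definition laminar :: "'k set set \<Rightarrow> bool" where
  "laminar l \<longleftrightarrow> (\<forall>A\<in>l. \<forall>B\<in>l. A \<subseteq> B \<or> B \<subseteq> A \<or> A \<inter> B = {})"

text \<open>A family \<open>l\<close> is the set of its members, so \<open>S(l)\<close> is \<open>l\<close> itself.\<close>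

definition laminar_families :: "'k set \<Rightarrow> 'k set set set" where
  "laminar_families K =
     {l. laminar l \<and> (\<forall>s\<in>l. s \<noteq> {} \<and> s \<subseteq> K) \<and> K \<in> l \<and> (\<forall>k\<in>K. {k} \<in> l)}"

text \<open>A partition is represented by the set of its parts: \<open>child_sets l s\<close> is \<open>P\<^sub>l(s)\<close>,
  and \<open>S\<^sub>l(p)\<close> is \<open>p\<close> itself.\<close>

definition child_sets :: "'k set set \<Rightarrow> 'k set \<Rightarrow> 'k set set" where
  "child_sets l s = {q \<in> l. q \<subset> s \<and> \<not> (\<exists>q'\<in>l. q \<subset> q' \<and> q' \<subset> s)}"

definition partitions :: "'k set set \<Rightarrow> 'k set set set" where
  "partitions l = {child_sets l s | s. s \<in> l \<and> 2 \<le> card s}"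

section \<open>The feasible sets and the map to subgraphs\<close>

text \<open>\<open>y_start\<close> is y-hat and \<open>y_end\<close> is y-bar. The vectors are total functions; only the
  components with indices in the ranges used in \<open>feasible\<close> are meaningful.\<close>

record ('v, 'k) sol =
  flow :: "'v \<times> 'v \<Rightarrow> 'k set \<Rightarrow> real"
  w :: "'v \<Rightarrow> 'k set set \<Rightarrow> real"
  y_start :: "'v \<Rightarrow> 'k set \<Rightarrow> real"
  y_end :: "'v \<Rightarrow> 'k set \<Rightarrow> real"

definition feasible ::
  "'v ugraph \<Rightarrow> 'v \<Rightarrow> 'k set \<Rightarrow> ('k \<Rightarrow> 'v) \<Rightarrow> 'k set set \<Rightarrow> ('v, 'k) sol set" where
  "feasible G r K t l = {x.
     (\<forall>a\<in>arcs G. \<forall>s\<in>l. flow x a s \<in> {0, 1}) \<and>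
     (\<forall>i\<in>fst G. \<forall>s\<in>l. y_start x i s \<in> {0, 1} \<and> y_end x i s \<in> {0, 1}) \<and>
     (\<forall>i\<in>fst G. \<forall>p\<in>partitions l. w x i p \<in> {0, 1}) \<and>
     (\<forall>i\<in>fst G. \<forall>s\<in>l.
        (\<Sum>a\<in>out_arcs G i. flow x a s) - (\<Sum>a\<in>in_arcs G i. flow x a s)
          = y_start x i s - y_end x i s) \<and>
     (\<forall>i\<in>fst G. \<forall>s\<in>l. 2 \<le> card s \<longrightarrow> w x i (child_sets l s) = y_end x i s) \<and>
     (\<forall>i\<in>fst G. \<forall>p\<in>partitions l. \<forall>s\<in>p. w x i p = y_start x i s) \<and>
     (\<forall>p\<in>partitions l. (\<Sum>i\<in>fst G. w x i p) = 1) \<and>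
     y_start x r K = 1 \<and> (\<forall>i\<in>fst G - {r}. y_start x i K = 0) \<and>
     (\<forall>k\<in>K. y_end x (t k) {k} = 1 \<and> (\<forall>i\<in>fst G - {t k}. y_end x i {k} = 0))}"

definition sol_cost ::
  "'v ugraph \<Rightarrow> ('v set \<Rightarrow> real) \<Rightarrow> 'k set set \<Rightarrow> ('v, 'k) sol \<Rightarrow> real" where
  "sol_cost G c l x = (\<Sum>a\<in>arcs G. arc_cost c a * (\<Sum>s\<in>l. flow x a s))"

definition phi :: "'k set set \<Rightarrow> ('v, 'k) sol \<Rightarrow> 'v set \<Rightarrow> real" where
  "phi l x e = min 1 (\<Sum>s\<in>l. \<Sum>a\<in>arcs_of_edge e. flow x a s)"

text \<open>The subgraph of \<open>G\<close> identified with a 0/1 vector \<open>\<chi>\<close> on its edges.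
  For a cost-optimal solution it can contain superfluous edges of cost 0 (for instance from a
  circulation of cost 0), in which case it need not be a tree or even connected.\<close>

definition induced_graph :: "'v ugraph \<Rightarrow> ('v set \<Rightarrow> real) \<Rightarrow> 'v ugraph" where
  "induced_graph G \<chi> = (\<Union>{e \<in> snd G. \<chi> e = 1}, {e \<in> snd G. \<chi> e = 1})"

end

theory Submission
  imports Defs
begin

text \<open>Let \<open>v\<close> be the optimal value over all laminar families and \<open>F\<close> the set of edges used by the
  optimal solution. The theorem follows from squeezing \<open>v\<close> between costs of Steiner trees.

  A feasible solution connects the terminals. Each set \<open>s\<close> of the family sends one unit of flow from
  the split node of its parent (the root, for \<open>s = K\<close>) to its own split node (the sink \<open>t k\<close>, for
  \<open>s = {k}\<close>), so the flows along the chain from \<open>K\<close> down to \<open>{k}\<close> join \<open>r\<close> to \<open>t k\<close>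
  (\<open>support_connects_sinks\<close>). Hence \<open>F\<close> contains a Steiner tree \<open>T\<close>
  (\<open>steiner_tree_in_connecting_edges\<close>), and the cost of \<open>F\<close> is at most \<open>v\<close>, because every edge of \<open>F\<close>
  carries at least one unit of flow (\<open>support_cost_le\<close>).

  Conversely, every Steiner tree is at least as expensive as some feasible solution of some family
  (\<open>steiner_tree_feasible\<close>): orient the tree away from \<open>r\<close> and let the commodities below a common edge
  travel together. To keep the construction recursive, the tree is decomposed at its root. If it
  starts with a single edge, this edge is added to the flow of the whole commodity set
  (\<open>routable_prepend_edge\<close>); otherwise a branch is split off, the commodity set falls into two parts,
  and the families of the parts are united under a new top set whose flow is empty
  (\<open>routable_split\<close>). Every edge is used by one flow only, so the cost does not grow.

  Together, cost \<open>T\<close> \<open>\<le>\<close> cost \<open>F\<close> \<open>\<le>\<close> \<open>v\<close> \<open>\<le>\<close> cost of any Steiner tree. Thus \<open>T\<close> is optimal, and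
  equality forces the edges in \<open>F - T\<close> to have cost 0.\<close>

section \<open>Reachability and finiteness\<close>

abbreviation adj :: "'v set set \<Rightarrow> ('v \<times> 'v) set" where
  "adj F \<equiv> {(i, j). {i, j} \<in> F}"

lemma sym_adj: "sym (adj F)"
  by (auto simp: sym_def insert_commute)

lemma adj_rtrancl_sym: "(u, v) \<in> (adj F)\<^sup>* \<Longrightarrow> (v, u) \<in> (adj F)\<^sup>*"
  using sym_rtrancl[OF sym_adj, of F] by (auto dest: symD)

lemma arcs_subset: "wf_ugraph G \<Longrightarrow> arcs G \<subseteq> fst G \<times> fst G"
  unfolding wf_ugraph_def arcs_def by auto

lemma finite_arcs: "wf_ugraph G \<Longrightarrow> finite (arcs G)"
  using arcs_subset[of G] finite_subset unfolding wf_ugraph_def by fastforce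

lemma finite_edges: "wf_ugraph G \<Longrightarrow> finite (snd G)"
  by (rule finite_subset[of _ "Pow (fst G)"]) (auto simp: wf_ugraph_def)

lemma finite_laminar_family: "\<lbrakk>finite K; l \<in> laminar_families K\<rbrakk> \<Longrightarrow> finite l"
  by (rule finite_subset[of _ "Pow K"]) (auto simp: laminar_families_def)

section \<open>Child sets of a laminar family\<close>

lemma Union_child_sets:
  assumes "finite K" "l \<in> laminar_families K" "s \<in> l" "2 \<le> card s"
  shows "\<Union>(child_sets l s) = s"
proof
  show "\<Union>(child_sets l s) \<subseteq> s" by (auto simp: child_sets_def)
  show "s \<subseteq> \<Union>(child_sets l s)"
  proof
    fix k assume k: "k \<in> s"
    let ?A = "{q \<in> l. k \<in> q \<and> q \<subset> s}"
    have "{k} \<noteq> s" using assms(4) by auto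
    then have "{k} \<in> ?A" using k assms(2,3) by (auto simp: laminar_families_def)
    moreover have "finite ?A" using finite_laminar_family[OF assms(1,2)] by simp
    ultimately obtain q where q: "q \<in> ?A" and max: "\<And>q'. q' \<in> ?A \<Longrightarrow> q \<subseteq> q' \<Longrightarrow> q = q'"
      by (metis (no_types, lifting) empty_iff finite_has_maximal)
    have "q \<in> child_sets l s" unfolding child_sets_def using q max by blast
    then show "k \<in> \<Union>(child_sets l s)" using q by blast
  qed
qed

lemma parent_exists:
  assumes "finite K" "l \<in> laminar_families K" "s \<in> l" "s \<noteq> K"
  obtains p where "p \<in> l" "s \<subset> p" "2 \<le> card p" "s \<in> child_sets l p"
proof -
  let ?A = "{q \<in> l. s \<subset> q}"
  have "K \<in> ?A" using assms by (auto simp: laminar_families_def)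
  moreover have "finite ?A" using finite_laminar_family[OF assms(1,2)] by simp
  ultimately obtain p where p: "p \<in> ?A" and min: "\<And>q. q \<in> ?A \<Longrightarrow> q \<subseteq> p \<Longrightarrow> p = q"
    by (metis (no_types, lifting) empty_iff finite_has_minimal)
  have "s \<in> child_sets l p" unfolding child_sets_def using p min assms(3) by blast
  moreover have "finite p" "s \<noteq> {}"
    using p assms by (auto simp: laminar_families_def intro: finite_subset)
  then have "card s < card p" "0 < card s"
    using p by (auto simp: psubset_card_mono card_gt_0_iff intro: finite_subset)
  moreover have "p \<in> l" "s \<subset> p" using p by auto
  ultimately show ?thesis using that[of p] by linarith
qed

section \<open>Feasible solutions connect the terminals\<close>

lemma sum_out_arcs:
  assumes "wf_ugraph G" "finite W"
  shows "(\<Sum>i\<in>W. \<Sum>a\<in>out_arcs G i. f a) = (\<Sum>a\<in>{a\<in>arcs G. fst a \<in> W}. (f a :: real))"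
proof -
  have "(\<Sum>i\<in>W. \<Sum>a\<in>out_arcs G i. f a)
      = (\<Sum>i\<in>W. \<Sum>a\<in>{a\<in>{a\<in>arcs G. fst a \<in> W}. fst a = i}. f a)"
    by (intro sum.cong) (auto simp: out_arcs_def)
  also have "\<dots> = (\<Sum>a\<in>{a\<in>arcs G. fst a \<in> W}. f a)"
    using assms finite_arcs[OF assms(1)] by (intro sum.group) auto
  finally show ?thesis .
qed

lemma sum_in_arcs:
  assumes "wf_ugraph G" "finite W"
  shows "(\<Sum>i\<in>W. \<Sum>a\<in>in_arcs G i. f a) = (\<Sum>a\<in>{a\<in>arcs G. snd a \<in> W}. (f a :: real))"
proof -
  have "(\<Sum>i\<in>W. \<Sum>a\<in>in_arcs G i. f a)
      = (\<Sum>i\<in>W. \<Sum>a\<in>{a\<in>{a\<in>arcs G. snd a \<in> W}. snd a = i}. f a)"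
    by (intro sum.cong) (auto simp: in_arcs_def)
  also have "\<dots> = (\<Sum>a\<in>{a\<in>arcs G. snd a \<in> W}. f a)"
    using assms finite_arcs[OF assms(1)] by (intro sum.group) auto
  finally show ?thesis .
qed

text \<open>A cut argument: no flow crosses the boundary of the set of nodes reachable from \<open>j\<close> in the
  support, so the divergences in this set sum to 0. The source contributes 1, hence the
  sink must lie in the set as well.\<close>

lemma flow_connects:
  fixes f :: "'v \<times> 'v \<Rightarrow> real"
  assumes wf: "wf_ugraph G" and j: "j \<in> fst G" and m: "m \<in> fst G"
    and div: "\<And>i. i \<in> fst G \<Longrightarrow>
      (\<Sum>a\<in>out_arcs G i. f a) - (\<Sum>a\<in>in_arcs G i. f a) = of_bool (i = j) - of_bool (i = m)"
    and supp: "\<And>p q. (p, q) \<in> arcs G \<Longrightarrow> f (p, q) \<noteq> 0 \<Longrightarrow> {p, q} \<in> F"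
  shows "(j, m) \<in> (adj F)\<^sup>*"
proof (rule ccontr)
  assume no: "(j, m) \<notin> (adj F)\<^sup>*"
  define W where "W = {i \<in> fst G. (j, i) \<in> (adj F)\<^sup>*}"
  have fin: "finite W" using wf by (simp add: W_def wf_ugraph_def)
  have cross: "p \<in> W \<longleftrightarrow> q \<in> W" if "(p, q) \<in> arcs G" "f (p, q) \<noteq> 0" for p q
  proof -
    have "(p, q) \<in> adj F" "(q, p) \<in> adj F"
      using supp[OF that] by (auto simp: insert_commute)
    moreover have "p \<in> fst G" "q \<in> fst G" using arcs_subset[OF wf] that by auto
    ultimately show ?thesis unfolding W_def
      by (metis (no_types, lifting) mem_Collect_eq rtrancl.rtrancl_into_rtrancl)
  qed
  have "(\<Sum>a\<in>{a\<in>arcs G. fst a \<in> W}. f a) = (\<Sum>a\<in>{a\<in>arcs G. fst a \<in> W \<and> snd a \<in> W}. f a)"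
    using finite_arcs[OF wf] cross by (intro sum.mono_neutral_right) auto
  also have "\<dots> = (\<Sum>a\<in>{a\<in>arcs G. snd a \<in> W}. f a)"
    using finite_arcs[OF wf] cross by (intro sum.mono_neutral_left) auto
  finally have "0 = (\<Sum>i\<in>W. (\<Sum>a\<in>out_arcs G i. f a) - (\<Sum>a\<in>in_arcs G i. f a))"
    by (simp add: sum_subtractf sum_out_arcs[OF wf fin] sum_in_arcs[OF wf fin])
  also have "\<dots> = (\<Sum>i\<in>W. of_bool (i = j))"
    using no by (intro sum.cong refl) (auto simp: W_def div)
  also have "\<dots> = 1"
    using j fin by (simp add: W_def of_bool_def)
  finally show False by simp
qed

lemma unique_one:
  fixes g :: "'a \<Rightarrow> real"
  assumes "finite A" "\<And>i. i \<in> A \<Longrightarrow> g i \<in> {0, 1}" "sum g A = 1"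
  obtains j where "j \<in> A" "\<And>i. i \<in> A \<Longrightarrow> g i = of_bool (i = j)"
proof -
  obtain j where j: "j \<in> A" "g j = 1"
    using assms by (metis insertE singletonD sum.neutral zero_neq_one)
  have "sum g (A - {j}) = 0" using assms j by (simp add: sum_diff1)
  then have "\<forall>i\<in>A - {j}. g i = 0"
    using assms(1,2) by (subst (asm) sum_nonneg_eq_0_iff) force+
  then show ?thesis using j that by force
qed

definition support :: "'v ugraph \<Rightarrow> 'k set set \<Rightarrow> ('v, 'k) sol \<Rightarrow> 'v set set" where
  "support G l x = {e \<in> snd G. phi l x e = 1}"

lemma edge_load_ge_one_iff:
  "phi l x e = 1 \<longleftrightarrow> 1 \<le> (\<Sum>s\<in>l. \<Sum>a\<in>arcs_of_edge e. flow x a s)"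
  by (auto simp: phi_def min_def)

lemma arcs_of_edge_subset: "e \<in> snd G \<Longrightarrow> arcs_of_edge e \<subseteq> arcs G"
  by (auto simp: arcs_of_edge_def arcs_def)

lemma finite_arcs_of_edge: "wf_ugraph G \<Longrightarrow> e \<in> snd G \<Longrightarrow> finite (arcs_of_edge e)"
  using arcs_of_edge_subset finite_arcs finite_subset by metis

lemma flow_in_support:
  assumes wf: "wf_ugraph G" and fin: "finite l" and x: "x \<in> feasible G r K t l"
    and s: "s \<in> l" and pq: "(p, q) \<in> arcs G" and nz: "flow x (p, q) s \<noteq> 0"
  shows "{p, q} \<in> support G l x"
proof -
  let ?e = "{p, q}"
  have e: "?e \<in> snd G" using pq by (simp add: arcs_def)
  have f: "flow x a s' \<in> {0, 1}" if "a \<in> arcs_of_edge ?e" "s' \<in> l" for a s'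
    using x that arcs_of_edge_subset[OF e] by (auto simp: feasible_def)
  have nn: "0 \<le> flow x a s'" if "a \<in> arcs_of_edge ?e" "s' \<in> l" for a s'
    using f[OF that] by auto
  have mem: "(p, q) \<in> arcs_of_edge ?e" by (simp add: arcs_of_edge_def)
  have "1 = flow x (p, q) s" using f[OF mem s] nz by auto
  also have "\<dots> \<le> (\<Sum>a\<in>arcs_of_edge ?e. flow x a s)"
    using nn s mem finite_arcs_of_edge[OF wf e] by (intro member_le_sum) auto
  also have "\<dots> \<le> (\<Sum>s\<in>l. \<Sum>a\<in>arcs_of_edge ?e. flow x a s)"
    using nn s fin by (intro member_le_sum sum_nonneg) auto
  finally show ?thesis using e by (simp add: support_def edge_load_ge_one_iff)
qed

text \<open>The start node of a set is the end node of its parent, so the flows along a chain of the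
  laminar family concatenate: by descent from \<open>K\<close>, all start nodes are reached from the root.\<close>

lemma start_node_reachable:
  assumes wf: "wf_ugraph G" and finK: "finite K" and r: "r \<in> fst G"
    and l: "l \<in> laminar_families K" and x: "x \<in> feasible G r K t l" and s: "s \<in> l"
  shows "\<exists>j\<in>fst G. (r, j) \<in> (adj (support G l x))\<^sup>* \<and>
    (\<forall>i\<in>fst G. y_start x i s = of_bool (i = j))"
  using s
proof (induction "card K - card s" arbitrary: s rule: less_induct)
  case less
  show ?case
  proof (cases "s = K")
    case True
    then show ?thesis using x r by (intro bexI[of _ r]) (auto simp: feasible_def)
  next
    case False
    obtain p where p: "p \<in> l" "s \<subset> p" "2 \<le> card p" "s \<in> child_sets l p"
      using parent_exists[OF finK l less.prems False] .
    have pK: "p \<subseteq> K" using p l by (auto simp: laminar_families_def)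
    have "card s < card p" "card p \<le> card K"
      using p pK finK by (auto intro: psubset_card_mono card_mono finite_subset)
    then obtain j where j: "j \<in> fst G" "(r, j) \<in> (adj (support G l x))\<^sup>*"
      and yj: "\<forall>i\<in>fst G. y_start x i p = of_bool (i = j)"
      using less.hyps[of p] p(1) by (meson diff_less_mono2 less_le_trans)
    let ?P = "child_sets l p"
    have P: "?P \<in> partitions l" using p by (auto simp: partitions_def)
    have "finite (fst G)" "(\<Sum>i\<in>fst G. w x i ?P) = 1"
      and "\<And>i. i \<in> fst G \<Longrightarrow> w x i ?P \<in> {0, 1}"
      using wf x P by (simp_all add: feasible_def wf_ugraph_def)
    then obtain m where m: "m \<in> fst G"
      and wm: "\<And>i. i \<in> fst G \<Longrightarrow> w x i ?P = of_bool (i = m)"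
      using unique_one[of "fst G" "\<lambda>i. w x i ?P"] by metis
    have ym: "y_end x i p = of_bool (i = m)" "y_start x i s = of_bool (i = m)"
      if i: "i \<in> fst G" for i
    proof -
      have "w x i ?P = y_end x i p" using x i p by (simp add: feasible_def)
      moreover have "\<forall>p\<in>partitions l. \<forall>s\<in>p. w x i p = y_start x i s"
        using x i by (simp add: feasible_def)
      then have "w x i ?P = y_start x i s" using p P by blast
      ultimately show "y_end x i p = of_bool (i = m)" "y_start x i s = of_bool (i = m)"
        using wm[OF i] by simp_all
    qed
    have "(j, m) \<in> (adj (support G l x))\<^sup>*"
    proof (rule flow_connects[OF wf j(1) m, where f = "\<lambda>a. flow x a p"])
      fix i assume "i \<in> fst G"
      then show "(\<Sum>a\<in>out_arcs G i. flow x a p) - (\<Sum>a\<in>in_arcs G i. flow x a p)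
          = of_bool (i = j) - of_bool (i = m)"
        using x p yj ym by (simp add: feasible_def)
    qed (rule flow_in_support[OF wf finite_laminar_family[OF finK l] x p(1)])
    then show ?thesis using j m ym by (meson rtrancl_trans)
  qed
qed

lemma support_connects_sinks:
  assumes wf: "wf_ugraph G" and finK: "finite K" and r: "r \<in> fst G"
    and l: "l \<in> laminar_families K" and x: "x \<in> feasible G r K t l"
    and k: "k \<in> K" and tk: "t k \<in> fst G"
  shows "(r, t k) \<in> (adj (support G l x))\<^sup>*"
proof -
  have kl: "{k} \<in> l" using k l by (auto simp: laminar_families_def)
  obtain j where j: "j \<in> fst G" "(r, j) \<in> (adj (support G l x))\<^sup>*"
      and yj: "\<forall>i\<in>fst G. y_start x i {k} = of_bool (i = j)"
    using start_node_reachable[OF wf finK r l x kl] by blast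
  have ye: "y_end x i {k} = of_bool (i = t k)" if "i \<in> fst G" for i
    using x k that by (auto simp: feasible_def)
  have "(j, t k) \<in> (adj (support G l x))\<^sup>*"
  proof (rule flow_connects[OF wf j(1) tk, where f = "\<lambda>a. flow x a {k}"])
    fix i assume "i \<in> fst G"
    then show "(\<Sum>a\<in>out_arcs G i. flow x a {k}) - (\<Sum>a\<in>in_arcs G i. flow x a {k})
        = of_bool (i = j) - of_bool (i = t k)"
      using x kl yj ye by (simp add: feasible_def)
  qed (rule flow_in_support[OF wf finite_laminar_family[OF finK l] x kl])
  then show ?thesis using j by (meson rtrancl_trans)
qed

lemma sol_cost_by_edges:
  assumes "wf_ugraph G"
  shows "sol_cost G c l x = (\<Sum>e\<in>snd G. c e * (\<Sum>s\<in>l. \<Sum>a\<in>arcs_of_edge e. flow x a s))"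
proof -
  let ?g = "\<lambda>a. arc_cost c a * (\<Sum>s\<in>l. flow x a s)"
  have "(\<Sum>e\<in>snd G. c e * (\<Sum>s\<in>l. \<Sum>a\<in>arcs_of_edge e. flow x a s))
      = (\<Sum>e\<in>snd G. \<Sum>a\<in>{a\<in>arcs G. {fst a, snd a} = e}. ?g a)"
  proof (intro sum.cong refl)
    fix e assume e: "e \<in> snd G"
    have "(\<Sum>s\<in>l. \<Sum>a\<in>arcs_of_edge e. flow x a s) = (\<Sum>a\<in>arcs_of_edge e. \<Sum>s\<in>l. flow x a s)"
      by (rule sum.swap)
    then have "c e * (\<Sum>s\<in>l. \<Sum>a\<in>arcs_of_edge e. flow x a s)
        = (\<Sum>a\<in>arcs_of_edge e. c e * (\<Sum>s\<in>l. flow x a s))"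
      by (simp only: sum_distrib_left)
    also have "\<dots> = (\<Sum>a\<in>{a\<in>arcs G. {fst a, snd a} = e}. ?g a)"
    proof (rule sum.cong)
      show "arcs_of_edge e = {a\<in>arcs G. {fst a, snd a} = e}"
        using e by (auto simp: arcs_of_edge_def arcs_def)
    qed (simp add: arc_cost_def)
    finally show "c e * (\<Sum>s\<in>l. \<Sum>a\<in>arcs_of_edge e. flow x a s)
        = (\<Sum>a\<in>{a\<in>arcs G. {fst a, snd a} = e}. ?g a)" .
  qed
  also have "\<dots> = sum ?g (arcs G)"
    using finite_arcs[OF assms] finite_edges[OF assms]
    by (intro sum.group) (auto simp: arcs_def)
  finally show ?thesis by (simp add: sol_cost_def)
qed

text \<open>\<open>sol_cost\<close> pays for an edge once per unit of flow on it, and an edge of the support carries at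
  least one unit.\<close>

lemma support_cost_le:
  assumes wf: "wf_ugraph G" and c: "\<forall>e\<in>snd G. 0 \<le> c e" and x: "x \<in> feasible G r K t l"
  shows "sum c (support G l x) \<le> sol_cost G c l x"
proof -
  let ?L = "\<lambda>e. \<Sum>s\<in>l. \<Sum>a\<in>arcs_of_edge e. flow x a s"
  have nn: "0 \<le> ?L e" if "e \<in> snd G" for e
  proof (intro sum_nonneg)
    fix s a assume "s \<in> l" "a \<in> arcs_of_edge e"
    then have "flow x a s \<in> {0, 1}"
      using x arcs_of_edge_subset[OF that] by (auto simp: feasible_def)
    then show "0 \<le> flow x a s" by auto
  qed
  have "sum c (support G l x) \<le> (\<Sum>e\<in>support G l x. c e * ?L e)"
  proof (rule sum_mono)
    fix e assume "e \<in> support G l x"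
    then show "c e \<le> c e * ?L e"
      using c mult_left_mono[of 1 "?L e" "c e"] by (auto simp: support_def edge_load_ge_one_iff)
  qed
  also have "\<dots> \<le> (\<Sum>e\<in>snd G. c e * ?L e)"
    using c nn finite_edges[OF wf] by (intro sum_mono2) (auto simp: support_def)
  finally show ?thesis by (simp add: sol_cost_by_edges[OF wf])
qed

section \<open>Steiner trees inside a connecting edge set\<close>

text \<open>Deleting the closing edge of a cycle preserves reachability, because the rest of the cycle
  is a detour around it.\<close>

lemma cycle_edge_redundant:
  assumes "ucycle (X, F) vs"
  shows "(adj F)\<^sup>* \<subseteq> (adj (F - {{last vs, hd vs}}))\<^sup>*"
proof -
  let ?F = "F - {{last vs, hd vs}}"
  have len: "3 \<le> length vs" and dist: "distinct vs"
    and suc: "successively (\<lambda>i j. {i, j} \<in> F) vs"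
    using assms by (auto simp: ucycle_def)
  have ne: "vs \<noteq> []" using len by auto
  have step: "(vs ! i, vs ! Suc i) \<in> adj ?F" if i: "Suc i < length vs" for i
  proof -
    have "{vs ! i, vs ! Suc i} \<in> F" using suc i by (simp add: successively_conv_nth)
    moreover have "{vs ! i, vs ! Suc i} \<noteq> {vs ! (length vs - 1), vs ! 0}"
    proof -
      have eq: "vs ! a = vs ! b \<longleftrightarrow> a = b" if "a < length vs" "b < length vs" for a b
        using dist that by (simp add: nth_eq_iff_index_eq)
      have "vs ! i \<noteq> vs ! (length vs - 1)" using i eq[of i "length vs - 1"] by simp
      moreover have "vs ! i \<noteq> vs ! 0 \<or> vs ! Suc i \<noteq> vs ! (length vs - 1)"
        using i len eq[of i 0] eq[of "Suc i" "length vs - 1"] by linarith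
      ultimately show ?thesis by (simp add: doubleton_eq_iff)
    qed
    ultimately show ?thesis using ne by (simp add: last_conv_nth hd_conv_nth)
  qed
  have "(vs ! 0, vs ! i) \<in> (adj ?F)\<^sup>*" if "i < length vs" for i
    using that
  proof (induction i)
    case (Suc i)
    then show ?case using step[of i] by (meson Suc_lessD rtrancl.rtrancl_into_rtrancl)
  qed simp
  from this[of "length vs - 1"] have hl: "(hd vs, last vs) \<in> (adj ?F)\<^sup>*"
    using ne by (simp add: last_conv_nth hd_conv_nth)
  have "adj F \<subseteq> (adj ?F)\<^sup>*"
  proof
    fix a assume a: "a \<in> adj F"
    obtain u v where uv: "a = (u, v)" by (cases a)
    show "a \<in> (adj ?F)\<^sup>*"
    proof (cases "{u, v} = {last vs, hd vs}")
      case True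
      then show ?thesis using hl adj_rtrancl_sym[OF hl] uv by (auto simp: doubleton_eq_iff)
    next
      case False
      then show ?thesis using a uv by auto
    qed
  qed
  then show ?thesis using rtrancl_subset_rtrancl by blast
qed

lemma unreachable_edge_redundant:
  assumes "(r, u) \<notin> (adj F)\<^sup>*" "(r, z) \<in> (adj F)\<^sup>*"
  shows "(r, z) \<in> (adj (F - {{u, v}}))\<^sup>*"
  using assms(2)
proof (induction rule: rtrancl_induct)
  case (step y z)
  have "(r, z) \<in> (adj F)\<^sup>*" using step by (meson rtrancl.rtrancl_into_rtrancl)
  then have "{y, z} \<noteq> {u, v}" using assms(1) step.hyps(1) by (auto simp: doubleton_eq_iff)
  then have "(y, z) \<in> adj (F - {{u, v}})" using step.hyps(2) by auto
  then show ?case using step.IH by (meson rtrancl.rtrancl_into_rtrancl)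
qed simp

text \<open>An inclusion-minimal edge set that connects the terminals has no cycle and no edge outside
  the component of \<open>r\<close>, since by the two preceding lemmas such an edge could be dropped.\<close>

lemma steiner_tree_in_connecting_edges:
  assumes wf: "wf_ugraph G" and F: "F \<subseteq> snd G" and r: "r \<in> R" and R2: "2 \<le> card R"
    and conn: "\<And>z. z \<in> R \<Longrightarrow> (r, z) \<in> (adj F)\<^sup>*"
  obtains F' where "F' \<subseteq> F" "steiner_tree G R (\<Union>F', F')"
proof -
  let ?A = "{F'. F' \<subseteq> F \<and> (\<forall>z\<in>R. (r, z) \<in> (adj F')\<^sup>*)}"
  have "finite F" using F finite_edges[OF wf] finite_subset by blast
  then have "finite ?A" by simp
  moreover have "F \<in> ?A" using conn by simp
  ultimately obtain F' where F': "F' \<in> ?A" and min: "\<And>F''. F'' \<in> ?A \<Longrightarrow> F'' \<subseteq> F' \<Longrightarrow> F' = F''"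
    by (metis (no_types, lifting) empty_iff finite_has_minimal)
  have sub: "F' \<subseteq> F" and reach: "\<And>z. z \<in> R \<Longrightarrow> (r, z) \<in> (adj F')\<^sup>*" using F' by auto
  have wfF: "wf_ugraph (\<Union>F', F')"
  proof -
    have "\<Union>F' \<subseteq> fst G" using wf F sub by (auto simp: wf_ugraph_def)
    then have "finite (\<Union>F')" using wf finite_subset by (auto simp: wf_ugraph_def)
    then show ?thesis using wf F sub by (auto simp: wf_ugraph_def)
  qed
  have inR: "r \<in> \<Union>F'"
  proof -
    have "\<not> R \<subseteq> {r}" using R2 card_mono[of "{r}" R] by auto
    then obtain z where "z \<in> R" "z \<noteq> r" by blast
    then obtain y where "(r, y) \<in> adj F'" using reach by (metis converse_rtranclE)
    then show ?thesis by auto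
  qed
  have RX: "R \<subseteq> \<Union>F'"
  proof
    fix z assume "z \<in> R"
    from reach[OF this] show "z \<in> \<Union>F'" using inR by cases auto
  qed
  have all: "(r, u) \<in> (adj F')\<^sup>*" if u: "u \<in> \<Union>F'" for u
  proof (rule ccontr)
    assume no: "(r, u) \<notin> (adj F')\<^sup>*"
    obtain e where e: "e \<in> F'" "u \<in> e" using u by blast
    then have "card e = 2" using wfF by (auto simp: wf_ugraph_def)
    then obtain v where v: "e = {u, v}" using e(2) by (auto simp: card_2_iff)
    have "F' - {e} \<in> ?A" using sub reach unreachable_edge_redundant[OF no] v by auto
    then have "F' = F' - {e}" by (rule min) auto
    then show False using e by auto
  qed
  have "connected_ugraph (\<Union>F', F')"
    unfolding connected_ugraph_def fst_conv snd_conv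
  proof (intro conjI ballI)
    show "\<Union>F' \<noteq> {}" using inR by blast
    fix a b assume ab: "a \<in> \<Union>F'" "b \<in> \<Union>F'"
    show "(a, b) \<in> (adj F')\<^sup>*"
      by (rule rtrancl_trans[OF adj_rtrancl_sym[OF all[OF ab(1)]] all[OF ab(2)]])
  qed
  moreover have "\<not> ucycle (\<Union>F', F') vs" for vs
  proof
    assume cyc: "ucycle (\<Union>F', F') vs"
    let ?e = "{last vs, hd vs}"
    have "F' - {?e} \<in> ?A" using sub reach subsetD[OF cycle_edge_redundant[OF cyc]] by auto
    then have "F' = F' - {?e}" by (rule min) auto
    then have "?e \<notin> F'" by auto
    then show False using cyc by (simp add: ucycle_def)
  qed
  moreover have "subgraph (\<Union>F', F') G"
    unfolding subgraph_def
  proof (intro conjI)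
    have "\<Union>(snd G) \<subseteq> fst G" using wf by (auto simp: wf_ugraph_def)
    then show "fst (\<Union>F', F') \<subseteq> fst G" using F sub by auto
  qed (use wfF F sub in auto)
  ultimately show ?thesis using that sub wfF RX by (simp add: steiner_tree_def is_tree_def)
qed

section \<open>Rooted trees\<close>

text \<open>\<open>arborescence F r X\<close>: the edge set \<open>F\<close> forms a tree with root \<open>r\<close> on the nodes \<open>X\<close>. Splitting
  off a single branch at the root, in place of all branches at once, is what turns a tree into a
  binary laminar family.\<close>

inductive arborescence :: "'v set set \<Rightarrow> 'v \<Rightarrow> 'v set \<Rightarrow> bool" where
  single: "arborescence {} r {r}"
| attach: "\<lbrakk>arborescence F1 r X1; arborescence F2 v X2; X1 \<inter> X2 = {}\<rbrakk> \<Longrightarrow>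
    arborescence (insert {r, v} (F1 \<union> F2)) r (X1 \<union> X2)"

lemma arborescence_basic:
  "arborescence F r X \<Longrightarrow> finite F \<and> r \<in> X \<and> \<Union>F \<subseteq> X"
  by (induction rule: arborescence.induct) auto

text \<open>The inductive rules build a tree from its root, whereas a search through a graph grows it at
  its leaves. The next lemma reconciles the two.\<close>

lemma arborescence_add_leaf:
  assumes "arborescence F r X" "u \<in> X" "z \<notin> X"
  shows "arborescence (insert {u, z} F) r (insert z X)"
  using assms
proof (induction rule: arborescence.induct)
  case (single r)
  then show ?case
    using arborescence.attach[OF arborescence.single[of r] arborescence.single[of z]] by auto
next
  case (attach F1 r X1 F2 v X2)
  show ?case
  proof (cases "u \<in> X1")
    case True
    then have "arborescence (insert {u, z} F1) r (insert z X1)" using attach by auto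
    from arborescence.attach[OF this attach.hyps(2)] show ?thesis
      using attach.hyps attach.prems by (simp add: insert_commute)
  next
    case False
    then have "arborescence (insert {u, z} F2) v (insert z X2)" using attach by auto
    from arborescence.attach[OF attach.hyps(1) this] show ?thesis
      using attach.hyps attach.prems by (simp add: insert_commute)
  qed
qed

lemma arborescence_extend_to:
  assumes "arborescence F r X" "F \<subseteq> E" "(r, z) \<in> (adj E)\<^sup>*"
  shows "\<exists>F' X'. arborescence F' r X' \<and> F' \<subseteq> E \<and> X \<subseteq> X' \<and> z \<in> X'"
  using assms(3)
proof (induction rule: rtrancl_induct)
  case base
  have "r \<in> X" using arborescence_basic[OF assms(1)] by simp
  then show ?case using assms(1,2) by blast
next
  case (step y z)
  then obtain F' X' where A: "arborescence F' r X'" "F' \<subseteq> E" "X \<subseteq> X'" "y \<in> X'" by blast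
  show ?case
  proof (cases "z \<in> X'")
    case False
    have "arborescence (insert {y, z} F') r (insert z X')"
      using arborescence_add_leaf[OF A(1,4) False] .
    moreover have "insert {y, z} F' \<subseteq> E" using A(2) step.hyps(2) by auto
    ultimately show ?thesis using A(3) by blast
  qed (use A in blast)
qed

lemma arborescence_spanning:
  assumes "finite Z" "\<And>z. z \<in> Z \<Longrightarrow> (r, z) \<in> (adj E)\<^sup>*"
  shows "\<exists>F X. arborescence F r X \<and> F \<subseteq> E \<and> Z \<subseteq> X"
  using assms
proof (induction Z rule: finite_induct)
  case empty
  show ?case using arborescence.single[of r] by blast
next
  case (insert z Z)
  then obtain F X where "arborescence F r X" "F \<subseteq> E" "Z \<subseteq> X" by auto
  with arborescence_extend_to[of F r X E z] insert.prems show ?case by blast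
qed

section \<open>Routings\<close>

definition unit_flow :: "'v ugraph \<Rightarrow> ('v \<times> 'v) set \<Rightarrow> 'v \<Rightarrow> 'v \<Rightarrow> bool" where
  "unit_flow G P u v \<longleftrightarrow> P \<subseteq> arcs G \<and>
     (\<forall>i\<in>fst G. (\<Sum>a\<in>out_arcs G i. of_bool (a \<in> P)) - (\<Sum>a\<in>in_arcs G i. of_bool (a \<in> P))
        = (of_bool (i = u) - of_bool (i = v) :: real))"

lemma unit_flow_empty: "unit_flow G {} u u"
  by (simp add: unit_flow_def)

lemma unit_flow_prepend_arc:
  assumes wf: "wf_ugraph G" and P: "unit_flow G P v z"
    and a: "(u, v) \<in> arcs G" "(u, v) \<notin> P"
  shows "unit_flow G (insert (u, v) P) u z"
proof -
  have split: "(of_bool (b \<in> insert (u, v) P) :: real) = of_bool (b \<in> P) + of_bool (b = (u, v))" for b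
    using a by auto
  have fin: "finite (out_arcs G i)" "finite (in_arcs G i)" for i
    using finite_arcs[OF wf] by (auto simp: out_arcs_def in_arcs_def)
  have delta: "(\<Sum>b\<in>A. of_bool (b = (u, v))) = (of_bool ((u, v) \<in> A) :: real)"
    if "finite A" for A
    using that by (simp add: of_bool_def)
  have out: "(\<Sum>b\<in>out_arcs G i. of_bool (b = (u, v))) = (of_bool (i = u) :: real)"
    and inn: "(\<Sum>b\<in>in_arcs G i. of_bool (b = (u, v))) = (of_bool (i = v) :: real)" for i
    unfolding delta[OF fin(1)] delta[OF fin(2)] using a
    by (auto simp: out_arcs_def in_arcs_def)
  show ?thesis
    unfolding unit_flow_def
  proof (intro conjI ballI)
    show "insert (u, v) P \<subseteq> arcs G" using P a by (simp add: unit_flow_def)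
    fix i assume "i \<in> fst G"
    then have "(\<Sum>a\<in>out_arcs G i. of_bool (a \<in> P)) - (\<Sum>a\<in>in_arcs G i. of_bool (a \<in> P))
        = (of_bool (i = v) - of_bool (i = z) :: real)"
      using P by (simp add: unit_flow_def)
    then show "(\<Sum>a\<in>out_arcs G i. of_bool (a \<in> insert (u, v) P))
        - (\<Sum>a\<in>in_arcs G i. of_bool (a \<in> insert (u, v) P))
        = (of_bool (i = u) - of_bool (i = z) :: real)"
      unfolding split sum.distrib out inn by simp
  qed
qed

text \<open>The combinatorial content of a feasible solution: \<open>\<alpha> s\<close> and \<open>\<beta> s\<close> are the nodes where the
  common flow of the commodities in \<open>s\<close> starts and ends, and \<open>P s\<close> is the set of its arcs.\<close>

definition routing ::
  "'v ugraph \<Rightarrow> 'v \<Rightarrow> 'k set \<Rightarrow> ('k \<Rightarrow> 'v) \<Rightarrow> 'k set set \<Rightarrow>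
    ('k set \<Rightarrow> 'v) \<Rightarrow> ('k set \<Rightarrow> 'v) \<Rightarrow> ('k set \<Rightarrow> ('v \<times> 'v) set) \<Rightarrow> bool" where
  "routing G r K t l \<alpha> \<beta> P \<longleftrightarrow> l \<in> laminar_families K \<and> \<alpha> K = r \<and>
     (\<forall>k\<in>K. \<beta> {k} = t k) \<and>
     (\<forall>s\<in>l. 2 \<le> card s \<longrightarrow> (\<forall>q\<in>child_sets l s. \<alpha> q = \<beta> s)) \<and>
     (\<forall>s\<in>l. \<beta> s \<in> fst G) \<and>
     (\<forall>s\<in>l. unit_flow G (P s) (\<alpha> s) (\<beta> s))"

lemma routing_feasible:
  assumes wf: "wf_ugraph G" and finK: "finite K" and R: "routing G r K t l \<alpha> \<beta> P"
    and r: "r \<in> fst G"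
  shows "\<exists>x\<in>feasible G r K t l. sol_cost G c l x = (\<Sum>s\<in>l. \<Sum>a\<in>P s. arc_cost c a)"
proof -
  have l: "l \<in> laminar_families K" using R by (simp add: routing_def)
  \<comment> \<open>A partition determines the set it partitions as its union, and the split node is where the
    flow of this set ends.\<close>
  define x where "x = \<lparr>flow = (\<lambda>a s. of_bool (a \<in> P s)), w = (\<lambda>i p. of_bool (i = \<beta> (\<Union>p))),
    y_start = (\<lambda>i s. of_bool (i = \<alpha> s)), y_end = (\<lambda>i s. of_bool (i = \<beta> s))\<rparr>"
  have part: "\<exists>s\<in>l. 2 \<le> card s \<and> p = child_sets l s \<and> \<Union>p = s" if "p \<in> partitions l" for p
    using that Union_child_sets[OF finK l] by (auto simp: partitions_def)
  have finV: "finite (fst G)" using wf by (simp add: wf_ugraph_def)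
  have "x \<in> feasible G r K t l"
    unfolding feasible_def mem_Collect_eq
  proof (intro conjI ballI impI)
    fix i s assume "i \<in> fst G" "s \<in> l" "2 \<le> card s"
    then show "w x i (child_sets l s) = y_end x i s"
      using Union_child_sets[OF finK l] by (simp add: x_def)
  next
    fix i p s assume "i \<in> fst G" and p: "p \<in> partitions l" "s \<in> p"
    then show "w x i p = y_start x i s"
      using part[OF p(1)] R by (auto simp: x_def routing_def)
  next
    fix p assume "p \<in> partitions l"
    then have "\<beta> (\<Union>p) \<in> fst G" using part R by (auto simp: routing_def)
    then show "(\<Sum>i\<in>fst G. w x i p) = 1" using finV by (simp add: x_def of_bool_def)
  qed (use R in \<open>auto simp: x_def routing_def unit_flow_def\<close>)
  moreover have "sol_cost G c l x = (\<Sum>s\<in>l. \<Sum>a\<in>arcs G. arc_cost c a * of_bool (a \<in> P s))"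
    unfolding sol_cost_def x_def by (simp add: sum_distrib_left) (rule sum.swap)
  moreover have "(\<Sum>a\<in>arcs G. arc_cost c a * of_bool (a \<in> P s)) = (\<Sum>a\<in>P s. arc_cost c a)"
    if "s \<in> l" for s
  proof -
    have "P s \<subseteq> arcs G" using R that by (simp add: routing_def unit_flow_def)
    then show ?thesis
      using finite_arcs[OF wf] by (intro sum.mono_neutral_cong_right) auto
  qed
  ultimately show ?thesis by auto
qed

text \<open>The bound on the cost refers to the arcs of all flows together, so an edge of \<open>F\<close> is paid for
  once although many commodities pass through it. That all arcs stay within \<open>F\<close> ensures that a new
  edge is not yet in use.\<close>

definition routable ::
  "'v ugraph \<Rightarrow> ('v set \<Rightarrow> real) \<Rightarrow> 'v \<Rightarrow> 'k set \<Rightarrow> ('k \<Rightarrow> 'v) \<Rightarrow> 'v set set \<Rightarrow> bool" where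
  "routable G c r K t F \<longleftrightarrow> (\<exists>l \<alpha> \<beta> P. routing G r K t l \<alpha> \<beta> P \<and>
     (\<forall>s\<in>l. P s \<subseteq> adj F) \<and> (\<Sum>s\<in>l. \<Sum>a\<in>P s. arc_cost c a) \<le> sum c F)"

lemma routable_mono:
  assumes "routable G c r K t F" "F \<subseteq> F'" "finite F'" "\<And>e. e \<in> F' \<Longrightarrow> 0 \<le> c e"
  shows "routable G c r K t F'"
proof -
  have "sum c F \<le> sum c F'" using assms by (intro sum_mono2) auto
  moreover have "adj F \<subseteq> adj F'" using assms(2) by auto
  ultimately show ?thesis using assms(1) unfolding routable_def by (meson order_trans)
qed

lemma routable_single:
  assumes "t k \<in> fst G"
  shows "routable G c (t k) {k} t {}"
proof -
  have "routing G (t k) {k} t {{k}} (\<lambda>_. t k) (\<lambda>_. t k) (\<lambda>_. {})"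
    using assms by (auto simp: routing_def laminar_families_def laminar_def unit_flow_empty)
  then show ?thesis unfolding routable_def by fastforce
qed

text \<open>Moving the root along a new edge only prolongs the flow of the whole set \<open>K\<close>, the one flow
  shared by all commodities.\<close>

lemma routable_prepend_edge:
  assumes wf: "wf_ugraph G" and finK: "finite K"
    and R: "routable G c v K t F" and F: "finite F" and e: "{r, v} \<in> snd G" "{r, v} \<notin> F"
  shows "routable G c r K t (insert {r, v} F)"
proof -
  obtain l \<alpha> \<beta> P where R: "routing G v K t l \<alpha> \<beta> P" and sub: "\<forall>s\<in>l. P s \<subseteq> adj F"
    and cost: "(\<Sum>s\<in>l. \<Sum>a\<in>P s. arc_cost c a) \<le> sum c F"
    using R unfolding routable_def by blast
  have l: "l \<in> laminar_families K" using R by (simp add: routing_def)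
  have Kl: "K \<in> l" and lK: "\<And>s. s \<in> l \<Longrightarrow> s \<subseteq> K" using l by (auto simp: laminar_families_def)
  have new: "(r, v) \<notin> P K" using sub Kl e(2) by blast
  let ?P = "P(K := insert (r, v) (P K))"
  have no_child: "q \<noteq> K" if "q \<in> child_sets l s" "s \<in> l" for q s
    using lK that by (auto simp: child_sets_def)
  have PK: "P K \<subseteq> arcs G" using R Kl by (simp add: routing_def unit_flow_def)
  have "routing G r K t l (\<alpha>(K := r)) \<beta> ?P"
    using R no_child unit_flow_prepend_arc[OF wf, of "P K" v "\<beta> K" r] Kl e(1) new
    unfolding routing_def by (auto simp: arcs_def)
  moreover have "\<forall>s\<in>l. ?P s \<subseteq> adj (insert {r, v} F)" using sub by (auto simp: insert_commute)
  moreover have "(\<Sum>s\<in>l. \<Sum>a\<in>?P s. arc_cost c a) \<le> sum c (insert {r, v} F)"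
  proof -
    have fin: "finite l" using finite_laminar_family[OF finK l] .
    have "finite (P K)" using PK finite_arcs[OF wf] finite_subset by blast
    then have "(\<Sum>a\<in>?P K. arc_cost c a) = c {r, v} + (\<Sum>a\<in>P K. arc_cost c a)"
      using new by (simp add: arc_cost_def)
    moreover have "(\<Sum>s\<in>l - {K}. \<Sum>a\<in>?P s. arc_cost c a) = (\<Sum>s\<in>l - {K}. \<Sum>a\<in>P s. arc_cost c a)"
      by (intro sum.cong) auto
    ultimately have "(\<Sum>s\<in>l. \<Sum>a\<in>?P s. arc_cost c a) = c {r, v} + (\<Sum>s\<in>l. \<Sum>a\<in>P s. arc_cost c a)"
      by (simp only: sum.remove[OF fin Kl])
    then show ?thesis using cost F e(2) by simp
  qed
  ultimately show ?thesis unfolding routable_def by blast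
qed

lemma child_sets_alt:
  "child_sets l s = {q. (q \<in> l \<and> q \<subset> s) \<and> (\<forall>q'. q' \<in> l \<and> q' \<subset> s \<longrightarrow> \<not> q \<subset> q')}"
  by (auto simp: child_sets_def)

lemma child_sets_disjoint_union:
  assumes l1: "l1 \<in> laminar_families K1" and l2: "l2 \<in> laminar_families K2"
    and disj: "K1 \<inter> K2 = {}" and s: "s \<in> l1"
  shows "child_sets (insert (K1 \<union> K2) (l1 \<union> l2)) s = child_sets l1 s"
proof -
  have sK: "s \<subseteq> K1" using l1 s by (simp add: laminar_families_def)
  have no2: "\<not> q \<subset> s" if "q \<in> l2" for q
  proof -
    have "q \<subseteq> K2" "q \<noteq> {}" using l2 that by (simp_all add: laminar_families_def)
    then show ?thesis using sK disj by blast
  qed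
  have "\<not> K1 \<union> K2 \<subset> s" using sK by blast
  then have "q \<in> insert (K1 \<union> K2) (l1 \<union> l2) \<and> q \<subset> s \<longleftrightarrow> q \<in> l1 \<and> q \<subset> s" for q
    using no2 by blast
  then show ?thesis by (simp only: child_sets_alt)
qed

lemma child_sets_top:
  assumes l1: "l1 \<in> laminar_families K1" and l2: "l2 \<in> laminar_families K2"
    and disj: "K1 \<inter> K2 = {}"
  shows "child_sets (insert (K1 \<union> K2) (l1 \<union> l2)) (K1 \<union> K2) = {K1, K2}"
proof -
  have 1: "K1 \<in> l1" "K1 \<noteq> {}" "\<And>s. s \<in> l1 \<Longrightarrow> s \<subseteq> K1 \<and> s \<noteq> {}"
    and 2: "K2 \<in> l2" "K2 \<noteq> {}" "\<And>s. s \<in> l2 \<Longrightarrow> s \<subseteq> K2 \<and> s \<noteq> {}"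
    using l1 l2 by (auto simp: laminar_families_def)
  have "s \<subset> K1 \<union> K2" if "s \<in> l1" for s
    using 1(3)[OF that] 2(2) disj by blast
  moreover have "s \<subset> K1 \<union> K2" if "s \<in> l2" for s
    using 2(3)[OF that] 1(2) disj by blast
  ultimately have "q \<in> insert (K1 \<union> K2) (l1 \<union> l2) \<and> q \<subset> K1 \<union> K2 \<longleftrightarrow> q \<in> l1 \<union> l2" for q
    by blast
  then have "child_sets (insert (K1 \<union> K2) (l1 \<union> l2)) (K1 \<union> K2)
      = {q. q \<in> l1 \<union> l2 \<and> (\<forall>q'. q' \<in> l1 \<union> l2 \<longrightarrow> \<not> q \<subset> q')}"
    by (simp only: child_sets_alt)
  also have "\<dots> = {K1, K2}"
  proof -
    have max1: "\<not> K1 \<subset> q \<and> \<not> K2 \<subset> q" if "q \<in> l1" for q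
      using 1(3)[OF that] 2(2) disj by blast
    have max2: "\<not> K1 \<subset> q \<and> \<not> K2 \<subset> q" if "q \<in> l2" for q
      using 2(3)[OF that] 1(2) disj by blast
    have "q \<in> l1 \<union> l2 \<and> (\<forall>q'. q' \<in> l1 \<union> l2 \<longrightarrow> \<not> q \<subset> q') \<longleftrightarrow> q = K1 \<or> q = K2" for q
    proof
      assume q: "q \<in> l1 \<union> l2 \<and> (\<forall>q'. q' \<in> l1 \<union> l2 \<longrightarrow> \<not> q \<subset> q')"
      then have "\<not> q \<subset> K1" "\<not> q \<subset> K2" using 1(1) 2(1) by simp_all
      moreover have "q \<subseteq> K1 \<or> q \<subseteq> K2" using q 1(3)[of q] 2(3)[of q] by auto
      ultimately show "q = K1 \<or> q = K2" by (auto simp: psubset_eq)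
    next
      assume "q = K1 \<or> q = K2"
      then show "q \<in> l1 \<union> l2 \<and> (\<forall>q'. q' \<in> l1 \<union> l2 \<longrightarrow> \<not> q \<subset> q')"
        using 1(1) 2(1) max1 max2 by (metis UnE UnI1 UnI2)
    qed
    then show ?thesis by auto
  qed
  finally show ?thesis .
qed

text \<open>Two edge-disjoint routings from the same root are joined by a new top set, whose own flow is
  empty: it splits at the root at once.\<close>

lemma routable_split:
  assumes r: "r \<in> fst G" and fin: "finite K1" "finite K2"
    and R1: "routable G c r K1 t F1" and R2: "routable G c r K2 t F2"
    and disj: "K1 \<inter> K2 = {}" and F: "finite F1" "finite F2" "F1 \<inter> F2 = {}"
  shows "routable G c r (K1 \<union> K2) t (F1 \<union> F2)"
proof -
  obtain l1 \<alpha>1 \<beta>1 P1 where R1: "routing G r K1 t l1 \<alpha>1 \<beta>1 P1"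
    and sub1: "\<forall>s\<in>l1. P1 s \<subseteq> adj F1"
    and cost1: "(\<Sum>s\<in>l1. \<Sum>a\<in>P1 s. arc_cost c a) \<le> sum c F1"
    using R1 unfolding routable_def by blast
  obtain l2 \<alpha>2 \<beta>2 P2 where R2: "routing G r K2 t l2 \<alpha>2 \<beta>2 P2"
    and sub2: "\<forall>s\<in>l2. P2 s \<subseteq> adj F2"
    and cost2: "(\<Sum>s\<in>l2. \<Sum>a\<in>P2 s. arc_cost c a) \<le> sum c F2"
    using R2 unfolding routable_def by blast
  have L1: "l1 \<in> laminar_families K1" and L2: "l2 \<in> laminar_families K2"
    using R1 R2 by (auto simp: routing_def)
  have 1: "K1 \<in> l1" "K1 \<noteq> {}" "\<And>s. s \<in> l1 \<Longrightarrow> s \<subseteq> K1 \<and> s \<noteq> {}" "\<And>k. k \<in> K1 \<Longrightarrow> {k} \<in> l1"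
    and 2: "K2 \<in> l2" "K2 \<noteq> {}" "\<And>s. s \<in> l2 \<Longrightarrow> s \<subseteq> K2 \<and> s \<noteq> {}" "\<And>k. k \<in> K2 \<Longrightarrow> {k} \<in> l2"
    using L1 L2 by (auto simp: laminar_families_def)
  let ?K = "K1 \<union> K2"
  let ?l = "insert ?K (l1 \<union> l2)"
  have n1: "?K \<notin> l1" using 1(3)[of ?K] 2(2) disj by blast
  have n2: "?K \<notin> l2" using 2(3)[of ?K] 1(2) disj by blast
  have l12: "s \<notin> l1" if "s \<in> l2" for s using 2(3)[OF that] 1(3)[of s] disj by blast
  have n1': "s \<noteq> ?K" if "s \<in> l1" for s using that n1 by blast
  have n2': "s \<noteq> ?K" if "s \<in> l2" for s using that n2 by blast
  have "laminar ?l"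
    unfolding laminar_def
  proof (intro ballI)
    fix A B assume A: "A \<in> ?l" and B: "B \<in> ?l"
    have 11: "A \<subseteq> B \<or> B \<subseteq> A \<or> A \<inter> B = {}" if "A \<in> l1" "B \<in> l1"
      using that L1 by (auto simp: laminar_families_def laminar_def)
    have 22: "A \<subseteq> B \<or> B \<subseteq> A \<or> A \<inter> B = {}" if "A \<in> l2" "B \<in> l2"
      using that L2 by (auto simp: laminar_families_def laminar_def)
    have 12: "X \<inter> Y = {}" if "X \<in> l1" "Y \<in> l2" for X Y
      using 1(3)[OF that(1)] 2(3)[OF that(2)] disj by blast
    have top: "X \<subseteq> ?K" if "X \<in> ?l" for X
      using that 1(3)[of X] 2(3)[of X] by blast
    consider "A = ?K" | "B = ?K" | "A \<in> l1" "B \<in> l1" | "A \<in> l2" "B \<in> l2"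
      | "A \<in> l1" "B \<in> l2" | "A \<in> l2" "B \<in> l1"
      using A B by blast
    then show "A \<subseteq> B \<or> B \<subseteq> A \<or> A \<inter> B = {}"
      using top[OF A] top[OF B] 11 22 12[of A B] 12[of B A] by cases (simp_all add: Int_commute)
  qed
  moreover have "\<forall>s\<in>?l. s \<noteq> {} \<and> s \<subseteq> ?K" using 1(2,3) 2(3) by blast
  moreover have "\<forall>k\<in>?K. {k} \<in> ?l" using 1(4) 2(4) by blast
  ultimately have L: "?l \<in> laminar_families ?K" by (simp add: laminar_families_def)
  have ch1: "child_sets ?l s = child_sets l1 s" if "s \<in> l1" for s
    using child_sets_disjoint_union[OF L1 L2 disj that] .
  have ch2: "child_sets ?l s = child_sets l2 s" if "s \<in> l2" for s
    using child_sets_disjoint_union[OF L2 L1 _ that] disj by (simp add: Un_commute Int_commute)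
  have chK: "child_sets ?l ?K = {K1, K2}" using child_sets_top[OF L1 L2 disj] .
  define \<alpha> where "\<alpha> s = (if s = ?K then r else if s \<in> l1 then \<alpha>1 s else \<alpha>2 s)" for s
  define \<beta> where "\<beta> s = (if s = ?K then r else if s \<in> l1 then \<beta>1 s else \<beta>2 s)" for s
  define P where "P s = (if s = ?K then {} else if s \<in> l1 then P1 s else P2 s)" for s
  have e1: "\<alpha> s = \<alpha>1 s" "\<beta> s = \<beta>1 s" "P s = P1 s" if "s \<in> l1" for s
    using that n1' by (auto simp: \<alpha>_def \<beta>_def P_def)
  have e2: "\<alpha> s = \<alpha>2 s" "\<beta> s = \<beta>2 s" "P s = P2 s" if "s \<in> l2" for s
    using that n2' l12 by (auto simp: \<alpha>_def \<beta>_def P_def)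
  have eK: "\<alpha> ?K = r" "\<beta> ?K = r" "P ?K = {}" by (auto simp: \<alpha>_def \<beta>_def P_def)
  have "routing G r ?K t ?l \<alpha> \<beta> P"
    unfolding routing_def
  proof (intro conjI ballI impI)
    fix k assume "k \<in> ?K"
    then show "\<beta> {k} = t k"
    proof
      assume "k \<in> K1" then show ?thesis using e1(2)[OF 1(4)] R1 by (simp add: routing_def)
    next
      assume "k \<in> K2" then show ?thesis using e2(2)[OF 2(4)] R2 by (simp add: routing_def)
    qed
  next
    fix s q assume s: "s \<in> ?l" "2 \<le> card s" and q: "q \<in> child_sets ?l s"
    consider "s = ?K" | "s \<in> l1" | "s \<in> l2" using s by blast
    then show "\<alpha> q = \<beta> s"
    proof cases
      case 1
      have "\<alpha> K1 = r" "\<alpha> K2 = r"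
        using e1(1)[OF \<open>K1 \<in> l1\<close>] e2(1)[OF \<open>K2 \<in> l2\<close>] R1 R2 by (auto simp: routing_def)
      moreover have "q = K1 \<or> q = K2" using q chK unfolding 1 by simp
      ultimately show ?thesis using 1 eK by auto
    next
      case 2
      have q': "q \<in> child_sets l1 s" using q ch1[OF 2] by simp
      then have "q \<in> l1" by (simp add: child_sets_def)
      then show ?thesis using e1 2 q' s R1 by (simp add: routing_def)
    next
      case 3
      have q': "q \<in> child_sets l2 s" using q ch2[OF 3] by simp
      then have "q \<in> l2" by (simp add: child_sets_def)
      then show ?thesis using e2 3 q' s R2 by (simp add: routing_def)
    qed
  next
    fix s assume "s \<in> ?l"
    then consider "s = ?K" | "s \<in> l1" | "s \<in> l2" by blast
    then show "\<beta> s \<in> fst G"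
      using eK r e1 e2 R1 R2 by cases (auto simp: routing_def)
  next
    fix s assume "s \<in> ?l"
    then consider "s = ?K" | "s \<in> l1" | "s \<in> l2" by blast
    then show "unit_flow G (P s) (\<alpha> s) (\<beta> s)"
      using eK e1 e2 R1 R2 by cases (auto simp: routing_def unit_flow_empty)
  qed (use L eK in simp_all)
  moreover have "\<forall>s\<in>?l. P s \<subseteq> adj (F1 \<union> F2)"
  proof
    fix s assume "s \<in> ?l"
    then consider "s = ?K" | "s \<in> l1" | "s \<in> l2" by blast
    then show "P s \<subseteq> adj (F1 \<union> F2)"
    proof cases
      case 1 then show ?thesis using eK by simp
    next
      case 2
      then have "P s \<subseteq> adj F1" using e1(3) sub1 by simp
      then show ?thesis by auto
    next
      case 3
      then have "P s \<subseteq> adj F2" using e2(3) sub2 by simp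
      then show ?thesis by auto
    qed
  qed
  moreover have "(\<Sum>s\<in>?l. \<Sum>a\<in>P s. arc_cost c a) \<le> sum c (F1 \<union> F2)"
  proof -
    have "finite l1" "finite l2" using finite_laminar_family fin L1 L2 by blast+
    moreover have "l1 \<inter> l2 = {}" using l12 by blast
    moreover have "?K \<notin> l1 \<union> l2" using n1 n2 by blast
    ultimately have "(\<Sum>s\<in>?l. \<Sum>a\<in>P s. arc_cost c a)
        = (\<Sum>s\<in>l1. \<Sum>a\<in>P s. arc_cost c a) + (\<Sum>s\<in>l2. \<Sum>a\<in>P s. arc_cost c a)"
      using eK by (simp add: sum.union_disjoint)
    also have "\<dots> = (\<Sum>s\<in>l1. \<Sum>a\<in>P1 s. arc_cost c a) + (\<Sum>s\<in>l2. \<Sum>a\<in>P2 s. arc_cost c a)"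
      using e1 e2 by simp
    also have "\<dots> \<le> sum c (F1 \<union> F2)"
      using cost1 cost2 F by (simp add: sum.union_disjoint)
    finally show ?thesis .
  qed
  ultimately show ?thesis unfolding routable_def by blast
qed

text \<open>The recursion along a rooted tree: the commodities in the branch at \<open>v\<close> share the edge from \<open>r\<close>
  to \<open>v\<close>, and they are separated at \<open>r\<close> from the others.\<close>

lemma arborescence_routable:
  assumes "arborescence F r X" and wf: "wf_ugraph G" and c: "\<And>e. e \<in> snd G \<Longrightarrow> 0 \<le> c e"
    and "F \<subseteq> snd G" "X \<subseteq> fst G" "finite K" "K \<noteq> {}" "inj_on t K" "t ` K \<subseteq> X"
  shows "routable G c r K t F"
  using assms(1,4-9)
proof (induction arbitrary: K rule: arborescence.induct)
  case (single r)
  then obtain k where k: "k \<in> K" by blast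
  have tr: "t k' = r" if "k' \<in> K" for k' using single.prems(6) that by auto
  have "k' = k" if "k' \<in> K" for k'
    using inj_onD[OF single.prems(5) _ that k] tr[OF that] tr[OF k] by simp
  then have "K = {k}" using k by blast
  moreover have "t k = r" using tr[OF k] .
  ultimately show ?case using routable_single[of t k G c] single.prems(2) by auto
next
  case (attach F1 r X1 F2 v X2)
  let ?F = "insert {r, v} (F1 \<union> F2)"
  define K1 where "K1 = {k\<in>K. t k \<in> X1}"
  define K2 where "K2 = {k\<in>K. t k \<in> X2}"
  have K: "K = K1 \<union> K2" "K1 \<inter> K2 = {}"
    using attach.prems attach.hyps(3) by (auto simp: K1_def K2_def)
  have finK: "finite K1" "finite K2" using attach.prems K by auto
  have inj: "inj_on t K1" "inj_on t K2" using attach.prems(5) K by (auto intro: inj_on_subset)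
  have b1: "finite F1" "r \<in> X1" "\<Union>F1 \<subseteq> X1" and b2: "finite F2" "v \<in> X2" "\<Union>F2 \<subseteq> X2"
    using arborescence_basic[OF attach.hyps(1)] arborescence_basic[OF attach.hyps(2)] by auto
  have r: "r \<in> fst G" using b1 attach.prems by auto
  have new: "{r, v} \<notin> F1" "{r, v} \<notin> F2" using b1 b2 attach.hyps(3) by auto
  have "e \<noteq> {}" if "e \<in> F1" for e
  proof -
    have "card e = 2" using that attach.prems(1) wf unfolding wf_ugraph_def by blast
    then show ?thesis by auto
  qed
  then have F12: "F1 \<inter> F2 = {}" using b1(3) b2(3) attach.hyps(3) by blast
  have nn: "\<And>e. e \<in> ?F \<Longrightarrow> 0 \<le> c e" using attach.prems(1) c by blast
  have 1: "routable G c r K1 t F1" if "K1 \<noteq> {}"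
    using attach.IH(1)[of K1] attach.prems inj finK that by (auto simp: K1_def)
  have 2: "routable G c r K2 t (insert {r, v} F2)" if "K2 \<noteq> {}"
  proof (rule routable_prepend_edge[OF wf finK(2) _ b2(1) _ new(2)])
    show "routable G c v K2 t F2"
      using attach.IH(2)[of K2] attach.prems inj finK that by (auto simp: K2_def)
    show "{r, v} \<in> snd G" using attach.prems(1) by blast
  qed
  consider "K1 = {}" "K2 \<noteq> {}" | "K1 \<noteq> {}" "K2 = {}" | "K1 \<noteq> {}" "K2 \<noteq> {}"
    using attach.prems(4) K by blast
  then show ?case
  proof cases
    case 1
    then show ?thesis using K 2 b1 b2 nn by (auto intro!: routable_mono[OF 2])
  next
    case 2
    then show ?thesis using K 1 b1 b2 nn by (auto intro!: routable_mono[OF 1])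
  next
    case 3
    have "routable G c r (K1 \<union> K2) t (F1 \<union> insert {r, v} F2)"
      using routable_split[OF r finK 1[OF 3(1)] 2[OF 3(2)] K(2)] b1 b2 F12 new by auto
    then show ?thesis using K by simp
  qed
qed

text \<open>An arborescence that is grown inside the tree until it contains all terminals may be smaller
  than the tree, which only lowers the cost.\<close>

lemma steiner_tree_feasible:
  assumes inst: "steiner_instance G c R r K t" and T: "steiner_tree G R T"
  shows "\<exists>l\<in>laminar_families K. \<exists>x\<in>feasible G r K t l. sol_cost G c l x \<le> graph_cost c T"
proof -
  have wf: "wf_ugraph G" and c: "\<And>e. e \<in> snd G \<Longrightarrow> 0 \<le> c e" and RV: "R \<subseteq> fst G"
    and R2: "2 \<le> card R" and r: "r \<in> R" and bij: "bij_betw t K (R - {r})"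
    using inst by (auto simp: steiner_instance_def)
  have finR: "finite R" using R2 card.infinite by force
  then have finK: "finite K" using bij bij_betw_finite by blast
  have "card K = card R - 1" using bij_betw_same_card[OF bij] finR r by simp
  then have Kne: "K \<noteq> {}" using R2 by auto
  have subT: "fst T \<subseteq> fst G" "snd T \<subseteq> snd G" and RT: "R \<subseteq> fst T"
    and wfT: "wf_ugraph T" and conn: "connected_ugraph T"
    using T by (auto simp: steiner_tree_def subgraph_def is_tree_def)
  have "\<And>z. z \<in> R \<Longrightarrow> (r, z) \<in> (adj (snd T))\<^sup>*"
    using conn RT r unfolding connected_ugraph_def by blast
  then obtain F X where A: "arborescence F r X" "F \<subseteq> snd T" "R \<subseteq> X"
    using arborescence_spanning[OF finR] by blast
  have XV: "X \<subseteq> fst G"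
  proof -
    have "X \<subseteq> insert r (\<Union>F)" using A(1) by (induction rule: arborescence.induct) auto
    then show ?thesis using A(2) wf subT r RV unfolding wf_ugraph_def by blast
  qed
  have "routable G c r K t F"
  proof (rule arborescence_routable[OF A(1) wf c _ XV finK Kne])
    show "F \<subseteq> snd G" using A(2) subT(2) by blast
    show "inj_on t K" using bij by (simp add: bij_betw_def)
    show "t ` K \<subseteq> X" using bij A(3) by (auto simp: bij_betw_def)
  qed
  then obtain l \<alpha> \<beta> P where rt: "routing G r K t l \<alpha> \<beta> P"
    and cost: "(\<Sum>s\<in>l. \<Sum>a\<in>P s. arc_cost c a) \<le> sum c F"
    unfolding routable_def by blast
  have "sum c F \<le> graph_cost c T"
    unfolding graph_cost_def using A subT c finite_edges[OF wfT] by (intro sum_mono2) auto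
  moreover have "l \<in> laminar_families K" using rt by (simp add: routing_def)
  ultimately show ?thesis
    using routing_feasible[OF wf finK rt, of c] r RV cost by force
qed

section \<open>Optimal solutions give minimum cost Steiner trees\<close>

theorem corollary1:
  fixes G :: "'v ugraph" and c :: "'v set \<Rightarrow> real" and R :: "'v set" and r :: 'v
    and K :: "'k set" and t :: "'k \<Rightarrow> 'v"
    and x :: "'k set set \<Rightarrow> ('v, 'k) sol" and l_star :: "'k set set"
  assumes inst: "steiner_instance G c R r K t"
    and nonempty: "\<forall>l\<in>laminar_families K. feasible G r K t l \<noteq> {}"
    and x_opt: "\<forall>l\<in>laminar_families K.
      is_arg_min (sol_cost G c l) (\<lambda>y. y \<in> feasible G r K t l) (x l)"
    and l_star_opt:
      "is_arg_min (\<lambda>l. sol_cost G c l (x l)) (\<lambda>l. l \<in> laminar_families K) l_star"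
  defines "H \<equiv> induced_graph G (phi l_star (x l_star))"
  shows "((\<forall>e\<in>snd H. 0 < c e) \<longrightarrow> min_cost_steiner_tree G c R H) \<and>
    (\<exists>T. min_cost_steiner_tree G c R T \<and> subgraph T H \<and> (\<forall>e\<in>snd H - snd T. c e = 0))"
proof -
  have wf: "wf_ugraph G" and c: "\<forall>e\<in>snd G. 0 \<le> c e" and RV: "R \<subseteq> fst G"
    and R2: "2 \<le> card R" and r: "r \<in> R" and bij: "bij_betw t K (R - {r})"
    using inst by (auto simp: steiner_instance_def)
  have "finite R" using R2 card.infinite by force
  then have finK: "finite K" using bij bij_betw_finite by blast
  have ls: "l_star \<in> laminar_families K" using l_star_opt by (simp add: is_arg_min_def)
  have xs: "x l_star \<in> feasible G r K t l_star" using x_opt ls by (simp add: is_arg_min_def)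
  define v where "v = sol_cost G c l_star (x l_star)"
  define F where "F = support G l_star (x l_star)"
  have H: "H = (\<Union>F, F)" by (simp add: H_def induced_graph_def F_def support_def)
  have FE: "F \<subseteq> snd G" by (auto simp: F_def support_def)
  have finF: "finite F" using FE finite_edges[OF wf] finite_subset by blast
  have lower: "v \<le> graph_cost c T" if T: "steiner_tree G R T" for T
  proof -
    obtain l y where l: "l \<in> laminar_families K" and y: "y \<in> feasible G r K t l"
      and le: "sol_cost G c l y \<le> graph_cost c T"
      using steiner_tree_feasible[OF inst T] by blast
    have "v \<le> sol_cost G c l (x l)"
      using l_star_opt l by (auto simp: is_arg_min_linorder v_def)
    also have "\<dots> \<le> sol_cost G c l y"
      using x_opt l y by (auto simp: is_arg_min_linorder)
    finally show ?thesis using le by simp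
  qed
  have upper: "sum c F \<le> v" using support_cost_le[OF wf c xs] by (simp add: F_def v_def)
  have "(r, z) \<in> (adj F)\<^sup>*" if z: "z \<in> R" for z
  proof (cases "z = r")
    case False
    then obtain k where "k \<in> K" "z = t k" using z bij by (auto simp: bij_betw_def)
    then show ?thesis
      using support_connects_sinks[OF wf finK _ ls xs] r RV z by (auto simp: F_def)
  qed simp
  then obtain F' where F': "F' \<subseteq> F" and st: "steiner_tree G R (\<Union>F', F')"
    using steiner_tree_in_connecting_edges[OF wf FE r R2] by blast
  have split: "sum c F = sum c F' + sum c (F - F')"
    using sum.subset_diff[OF F' finF, of c] by simp
  have "0 \<le> sum c (F - F')" using c FE by (intro sum_nonneg) auto
  moreover have "v \<le> sum c F'" using lower[OF st] by (simp add: graph_cost_def)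
  ultimately have F'v: "sum c F' = v" and "sum c (F - F') = 0" using split upper by auto
  then have zero: "\<forall>e\<in>F - F'. c e = 0"
    using c FE finF by (subst (asm) sum_nonneg_eq_0_iff) auto
  have opt: "min_cost_steiner_tree G c R (\<Union>F', F')"
    unfolding min_cost_steiner_tree_def is_arg_min_linorder
    using st lower F'v by (simp add: graph_cost_def)
  have "subgraph (\<Union>F', F') H"
    using st F' by (auto simp: H subgraph_def steiner_tree_def)
  then have ex: "\<exists>T. min_cost_steiner_tree G c R T \<and> subgraph T H \<and> (\<forall>e\<in>snd H - snd T. c e = 0)"
    using opt zero by (intro exI[of _ "(\<Union>F', F')"]) (simp add: H)
  have "min_cost_steiner_tree G c R H" if pos: "\<forall>e\<in>snd H. 0 < c e"
  proof -
    have "F' = F" using pos zero F' by (force simp: H)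
    then show ?thesis using opt by (simp add: H)
  qed
  then show ?thesis using ex by blast
qed

end
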